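(* Let $X$ be an arbitrary real Banach space (of dimension at least $2$). Then $\delta_X^+(\varepsilon)\asymp\lambda_X^+(\varepsilon)$ as $\varepsilon \to 0$, and the following inequalities hold: $$\delta_X^+(2r) \le \lambda_X^+(r) \quad \text{for all } r \in [0,1];$$ $$\lambda_X^+(r) \le 2\,\delta_X^+(3r) \quad \text{for all } r \in \left[0,\tfrac{2}{3}\right].$$
   Context: Let $X$ be a real Banach space with $\dim X \ge 2$. Write $S_X=\{x\in X:\|x\|=1\}$. For $x\in X\setminus\{0\}$ and $y\in X$, $y$ is quasiorthogonal to $x$, written $y\urcorner x$, if there is a functional $p\in X^*$ with $\|p\|=1$, $p(x)=\|x\|$ and $p(y)=0$. For $x,y\in S_X$ with $y\urcorner x$ and $r\in[0,1]$ put $\lambda_X(x,y,r)=\min\{\lambda\in\mathbb{R}:\ \|x+ry-\lambda x\|=1\}$. The modulus of supporting smoothness is $$\lambda_X^+(r)=\sup\{\lambda_X(x,y,t):\ x,y\in S_X,\ y\urcorner x,\ 0\le t\le r\},\quad r\in[0,1].$$ The Bana\'s modulus is $\delta_X^+(\varepsilon)=\sup\{1-\frac{\|x+y\|}{2}:\ x,y\in S_X,\ \|x-y\|\le\varepsilon\}$, $\varepsilon\in[0,2]$. Two non-negative functions $f,g$, each defined on a segment with left endpoint $0$, are equivalent at zero, written $f(t)\asymp g(t)$ as $t\to0$, if there are positive constants $a,b,c,d,e$ such that $a f(bt)\le g(t)\le c f(dt)$ for all $t\in[0,e]$. *)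

theory Defs
  imports "HOL-Analysis.Analysis"
begin

definition quasiorthogonal :: "'a::real_normed_vector \<Rightarrow> 'a \<Rightarrow> bool" where
  "quasiorthogonal y x \<longleftrightarrow>
     (\<exists>p :: 'a \<Rightarrow>\<^sub>L real. norm p = 1 \<and> blinfun_apply p x = norm x \<and> blinfun_apply p y = 0)"

(* For x, y on the unit sphere with y quasiorthogonal to x and r in [0,1] the minimum exists,
   and LEAST denotes it; for other arguments the value is unspecified. *)
definition supp_depth :: "'a::real_normed_vector \<Rightarrow> 'a \<Rightarrow> real \<Rightarrow> real" where
  "supp_depth x y r = (LEAST l :: real. norm (x + r *\<^sub>R y - l *\<^sub>R x) = 1)"

(* The space is given by its type.  Both suprema are over nonempty sets of reals bounded by 1
   on the intended ranges r in [0,1] (for spaces of dimension at least 2) and eps in [0,2]. *)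
definition supp_smoothness_modulus :: "'a::real_normed_vector itself \<Rightarrow> real \<Rightarrow> real" where
  "supp_smoothness_modulus (_ :: 'a itself) r =
     Sup {supp_depth x y t | (x :: 'a) y t.
            x \<in> sphere 0 1 \<and> y \<in> sphere 0 1 \<and> quasiorthogonal y x \<and> 0 \<le> t \<and> t \<le> r}"

definition Banas_modulus :: "'a::real_normed_vector itself \<Rightarrow> real \<Rightarrow> real" where
  "Banas_modulus (_ :: 'a itself) eps =
     Sup {1 - norm (x + y) / 2 | (x :: 'a) y.
            x \<in> sphere 0 1 \<and> y \<in> sphere 0 1 \<and> norm (x - y) \<le> eps}"

(* f is regarded as a function on the segment {0..u} and g as one on {0..v}; all arguments
   occurring in the two-sided estimate are required to lie in these segments. *)
definition equivalent_at_zero ::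
    "real \<Rightarrow> (real \<Rightarrow> real) \<Rightarrow> real \<Rightarrow> (real \<Rightarrow> real) \<Rightarrow> bool" where
  "equivalent_at_zero u f v g \<longleftrightarrow>
     (\<forall>t\<in>{0..u}. 0 \<le> f t) \<and> (\<forall>t\<in>{0..v}. 0 \<le> g t) \<and>
     (\<exists>a b c d e. 0 < a \<and> 0 < b \<and> 0 < c \<and> 0 < d \<and> 0 < e \<and>
        (\<forall>t\<in>{0..e}. t \<in> {0..v} \<and> b * t \<in> {0..u} \<and> d * t \<in> {0..u} \<and>
           a * f (b * t) \<le> g t \<and> g t \<le> c * f (d * t)))"

end

theory Submission
  imports Defs
begin

text \<open>
  Both moduli are governed by the geometry of two-dimensional sections of the unit ball.

  A vector \<open>y\<close> is quasiorthogonal to a unit vector \<open>x\<close> exactly when it is Birkhoff orthogonal: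
  \<open>\<parallel>x + s y\<parallel> \<ge> 1\<close> for all real \<open>s\<close>.  One direction evaluates the functional; the other is the
  Hahn--Banach theorem (\<open>quasiorthogonalI\<close>).  Birkhoff orthogonal pairs are easy to find: the point
  of a line closest to the origin is orthogonal to the direction of the line
  (\<open>birkhoff_unit_exists\<close>).

  For \<open>\<delta>\<^sup>+(2r) \<le> \<lambda>\<^sup>+(r)\<close>, take a chord \<open>[y, x]\<close> of length \<open>2t\<close> with midpoint \<open>m\<close> and unit direction
  \<open>z\<close>.  In the plane of the chord let \<open>u\<close> be a highest point of the ball above the direction \<open>z\<close>, so
  that \<open>z\<close> is quasiorthogonal to \<open>u\<close>, and write \<open>m = \<alpha> u + \<beta> z\<close>, where \<open>\<alpha> \<le> \<parallel>m\<parallel>\<close>.  Since \<open>\<alpha> u\<close> lies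
  between the ends of the chord, one of the two ends is at most \<open>t\<close> away from \<open>\<alpha> u\<close>.  On that side,
  the line \<open>u \<plusminus> t z + \<real> u\<close> has already left the ball at height \<open>\<alpha>\<close>, so the depth is at least
  \<open>1 - \<alpha> \<ge> 1 - \<parallel>m\<parallel>\<close> (\<open>chord_sagitta_le_supp_depth\<close>).  This argument needs \<open>t < 1\<close>.  For \<open>t = 1\<close> the
  left side is at most \<open>1\<close>, and a pair of depth at least \<open>1\<close> is constructed from an end point of a
  face of a plane section (\<open>supp_depth_one_exists\<close>).

  For \<open>\<lambda>\<^sup>+(r) \<le> 2 \<delta>\<^sup>+(3r)\<close>, the two points of the sphere below \<open>x + t y\<close> and \<open>x - t y\<close>, at depths
  \<open>\<lambda>\<close> and \<open>\<mu>\<close> in \<open>[0, t]\<close>, have the sum \<open>(2 - \<lambda> - \<mu>) x\<close> and differ by at most \<open>3t\<close>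
  (\<open>supp_depth_le_chord_sagitta\<close>).  The equivalence at zero is immediate from the two inequalities.
\<close>

section \<open>The Hahn--Banach theorem for sublinear functionals\<close>

definition sublinear :: "('a::real_vector \<Rightarrow> real) \<Rightarrow> bool" where
  "sublinear q \<longleftrightarrow> (\<forall>x y. q (x + y) \<le> q x + q y) \<and> (\<forall>c x. 0 \<le> c \<longrightarrow> q (c *\<^sub>R x) = c * q x)"

lemma sublinear_add: "sublinear q \<Longrightarrow> q (x + y) \<le> q x + q y"
  by (simp add: sublinear_def)

lemma sublinear_scale: "sublinear q \<Longrightarrow> 0 \<le> c \<Longrightarrow> q (c *\<^sub>R x) = c * q x"
  by (simp add: sublinear_def)

lemma sublinear_zero: "sublinear q \<Longrightarrow> q 0 = 0"
  using sublinear_scale[of q 0 0] by simp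

lemma sublinear_neg_le: "sublinear q \<Longrightarrow> - q (- x) \<le> q x"
  using sublinear_add[of q x "- x"] sublinear_zero[of q] by simp

lemma sublinearI:
  assumes add: "\<And>x y. q (x + y) \<le> q x + q y"
    and zero: "q 0 = 0"
    and scale: "\<And>c x. 0 < c \<Longrightarrow> q (c *\<^sub>R x) \<le> c * q x"
  shows "sublinear q"
proof -
  have "q (c *\<^sub>R x) = c * q x" if "0 \<le> c" for c x
  proof (cases "c = 0")
    case False
    with that have c: "0 < c" by simp
    have "q (inverse c *\<^sub>R (c *\<^sub>R x)) \<le> inverse c * q (c *\<^sub>R x)"
      using c by (intro scale) simp
    then have "c * q x \<le> q (c *\<^sub>R x)" using c by (simp add: field_simps)
    with scale[OF c, of x] show ?thesis by simp
  qed (simp add: zero)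
  with add show ?thesis by (simp add: sublinear_def)
qed

text \<open>
  The largest sublinear functional below \<open>q\<close> that is linear on the line \<open>\<real> y\<close> and agrees with \<open>q\<close> at \<open>y\<close>.
\<close>

definition tilt :: "('a::real_vector \<Rightarrow> real) \<Rightarrow> 'a \<Rightarrow> 'a \<Rightarrow> real" where
  "tilt q y v = (INF t\<in>{0..}. q (v + t *\<^sub>R y) - t * q y)"

lemma tilt_bdd:
  assumes "sublinear q"
  shows "bdd_below ((\<lambda>t. q (v + t *\<^sub>R y) - t * q y) ` {0..})"
proof (rule bdd_belowI2)
  fix t :: real assume "t \<in> {0..}"
  then have "t * q y = q (t *\<^sub>R y)" using assms by (simp add: sublinear_scale)
  also have "\<dots> \<le> q (v + t *\<^sub>R y) + q (- v)"
    using sublinear_add[OF assms, of "v + t *\<^sub>R y" "- v"] by simp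
  finally show "- q (- v) \<le> q (v + t *\<^sub>R y) - t * q y" by simp
qed

lemma tilt_le:
  assumes "sublinear q" "0 \<le> t"
  shows "tilt q y v \<le> q (v + t *\<^sub>R y) - t * q y"
  unfolding tilt_def using tilt_bdd[OF assms(1)] assms(2) by (intro cINF_lower) auto

lemma tilt_ge:
  assumes "\<And>t. 0 \<le> t \<Longrightarrow> b \<le> q (v + t *\<^sub>R y) - t * q y"
  shows "b \<le> tilt q y v"
  unfolding tilt_def using assms by (intro cINF_greatest) auto

lemma tilt_sublinear:
  assumes q: "sublinear q"
  shows "sublinear (tilt q y)"
proof (rule sublinearI)
  fix v w
  have "tilt q y (v + w) - (q (w + s *\<^sub>R y) - s * q y) \<le> tilt q y v" if s: "0 \<le> s" for s
  proof (rule tilt_ge)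
    fix t :: real assume t: "0 \<le> t"
    have "tilt q y (v + w) \<le> q ((v + w) + (t + s) *\<^sub>R y) - (t + s) * q y"
      using s t by (intro tilt_le[OF q]) simp
    also have "q ((v + w) + (t + s) *\<^sub>R y) \<le> q (v + t *\<^sub>R y) + q (w + s *\<^sub>R y)"
      using sublinear_add[OF q, of "v + t *\<^sub>R y" "w + s *\<^sub>R y"] by (simp add: algebra_simps)
    finally show "tilt q y (v + w) - (q (w + s *\<^sub>R y) - s * q y) \<le> q (v + t *\<^sub>R y) - t * q y"
      by (simp add: algebra_simps)
  qed
  then have "tilt q y (v + w) - tilt q y v \<le> tilt q y w"
    by (intro tilt_ge) (simp add: algebra_simps)
  then show "tilt q y (v + w) \<le> tilt q y v + tilt q y w" by simp
next
  have "tilt q y 0 \<le> 0" using tilt_le[OF q, of 0 y 0] sublinear_zero[OF q] by simp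
  moreover have "0 \<le> tilt q y 0"
    by (rule tilt_ge) (simp add: sublinear_scale[OF q])
  ultimately show "tilt q y 0 = 0" by simp
next
  fix c :: real and v assume c: "0 < c"
  have "tilt q y (c *\<^sub>R v) / c \<le> tilt q y v"
  proof (rule tilt_ge)
    fix t :: real assume t: "0 \<le> t"
    have "tilt q y (c *\<^sub>R v) \<le> q (c *\<^sub>R v + (c * t) *\<^sub>R y) - (c * t) * q y"
      using c t by (intro tilt_le[OF q]) simp
    also have "c *\<^sub>R v + (c * t) *\<^sub>R y = c *\<^sub>R (v + t *\<^sub>R y)" by (simp add: scaleR_add_right)
    also have "q \<dots> = c * q (v + t *\<^sub>R y)" using c by (simp add: sublinear_scale[OF q])
    finally have "tilt q y (c *\<^sub>R v) \<le> c * (q (v + t *\<^sub>R y) - t * q y)"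
      by (simp add: right_diff_distrib mult.assoc)
    then show "tilt q y (c *\<^sub>R v) / c \<le> q (v + t *\<^sub>R y) - t * q y"
      using c by (simp add: divide_le_eq mult.commute)
  qed
  then show "tilt q y (c *\<^sub>R v) \<le> c * tilt q y v"
    using c by (simp add: divide_le_eq mult.commute)
qed

lemma tilt_le_self: "sublinear q \<Longrightarrow> tilt q y v \<le> q v"
  using tilt_le[of q 0 y v] by simp

text \<open>
  Tilting a minimal sublinear functional \<open>q\<close> along \<open>y\<close> cannot lower it, and this says that \<open>q\<close> is
  superadditive.
\<close>

lemma minimal_sublinear_imp_linear:
  assumes q: "sublinear q"
    and min: "\<And>q'. sublinear q' \<Longrightarrow> (\<And>v. q' v \<le> q v) \<Longrightarrow> q' = q"
  shows "linear q"
proof -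
  have add: "q (v + y) = q v + q y" for v y
  proof -
    have "tilt q y = q" using q by (intro min tilt_sublinear tilt_le_self)
    then have "q v \<le> q (v + y) - q y" using tilt_le[OF q, of 1 y v] by simp
    with sublinear_add[OF q, of v y] show ?thesis by simp
  qed
  have neg: "q (- v) = - q v" for v
    using add[of v "- v"] sublinear_zero[OF q] by simp
  show ?thesis
  proof (rule linearI)
    fix c :: real and v
    show "q (c *\<^sub>R v) = c *\<^sub>R q v"
    proof (cases "0 \<le> c")
      case False
      then show ?thesis
        using sublinear_scale[OF q, of "- c" v] neg[of "c *\<^sub>R v"] by simp
    qed (simp add: sublinear_scale[OF q])
  qed (rule add)
qed

lemma chain_Inf_sublinear:
  assumes "C \<noteq> {}"
    and sub: "\<And>f. f \<in> C \<Longrightarrow> sublinear f"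
    and below: "\<And>f v. f \<in> C \<Longrightarrow> f v \<le> d v"
    and chain: "\<And>f g. f \<in> C \<Longrightarrow> g \<in> C \<Longrightarrow> f \<le> g \<or> g \<le> f"
  shows "sublinear (\<lambda>v. INF f\<in>C. f v)" and "\<And>f v. f \<in> C \<Longrightarrow> (INF f\<in>C. f v) \<le> f v"
proof -
  have bdd: "bdd_below ((\<lambda>f. f v) ` C)" for v
  proof (rule bdd_belowI2)
    fix f assume f: "f \<in> C"
    show "- d (- v) \<le> f v"
      using sublinear_neg_le[OF sub[OF f], of v] below[OF f, of "- v"] by simp
  qed
  show lower: "(INF f\<in>C. f v) \<le> f v" if "f \<in> C" for f v
    using bdd that by (rule cINF_lower)
  show "sublinear (\<lambda>v. INF f\<in>C. f v)"
  proof (rule sublinearI)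
    fix v w
    have "(INF f\<in>C. f (v + w)) \<le> f v + g w" if f: "f \<in> C" and g: "g \<in> C" for f g
    proof -
      \<comment> \<open>The smaller of the two functionals bounds both summands.\<close>
      obtain h where h: "h \<in> C" "h \<le> f" "h \<le> g" using chain[OF f g] f g by blast
      have "(INF f\<in>C. f (v + w)) \<le> h (v + w)" by (rule lower[OF h(1)])
      also have "\<dots> \<le> h v + h w" by (rule sublinear_add[OF sub[OF h(1)]])
      also have "\<dots> \<le> f v + g w" using h(2,3) by (simp add: le_fun_def add_mono)
      finally show ?thesis .
    qed
    then have "(INF f\<in>C. f (v + w)) - g w \<le> (INF f\<in>C. f v)" if "g \<in> C" for g
      using that \<open>C \<noteq> {}\<close> by (intro cINF_greatest) (auto simp: algebra_simps)
    then have "(INF f\<in>C. f (v + w)) - (INF f\<in>C. f v) \<le> (INF f\<in>C. f w)"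
      using \<open>C \<noteq> {}\<close> by (intro cINF_greatest) (auto simp: algebra_simps)
    then show "(INF f\<in>C. f (v + w)) \<le> (INF f\<in>C. f v) + (INF f\<in>C. f w)" by simp
  next
    have "(\<lambda>f. f 0) ` C = {0}" using \<open>C \<noteq> {}\<close> sub by (auto simp: sublinear_zero)
    then show "(INF f\<in>C. f 0) = 0" by simp
  next
    fix c :: real and v assume c: "0 < c"
    have "(INF f\<in>C. f (c *\<^sub>R v)) / c \<le> (INF f\<in>C. f v)"
    proof (rule cINF_greatest[OF \<open>C \<noteq> {}\<close>])
      fix f assume f: "f \<in> C"
      show "(INF f\<in>C. f (c *\<^sub>R v)) / c \<le> f v"
        using lower[OF f, of "c *\<^sub>R v"] sublinear_scale[OF sub[OF f], of c v] c
        by (simp add: divide_le_eq mult.commute)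
    qed
    then show "(INF f\<in>C. f (c *\<^sub>R v)) \<le> c * (INF f\<in>C. f v)"
      using c by (simp add: divide_le_eq mult.commute)
  qed
qed

lemma sublinear_dominates_linear:
  fixes d :: "'a::real_vector \<Rightarrow> real"
  assumes d: "sublinear d"
  shows "\<exists>p. linear p \<and> (\<forall>v. p v \<le> d v)"
proof -
  define A where "A = {q. sublinear q \<and> q \<le> d}"
  let ?R = "relation_of (\<lambda>f g. g \<le> f) A"
  have po: "partial_order_on A ?R"
    by (rule partial_order_on_relation_ofI) auto
  have ub: "\<exists>u\<in>A. \<forall>a\<in>C. u \<le> a" if C: "C \<in> Chains ?R" for C
  proof (cases "C = {}")
    case True
    then show ?thesis using d by (auto simp: A_def)
  next
    case False
    have CA: "C \<subseteq> A" and chain: "\<And>f g. f \<in> C \<Longrightarrow> g \<in> C \<Longrightarrow> f \<le> g \<or> g \<le> f"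
      using C by (auto simp: Chains_def relation_of_def)
    have sub: "\<And>f. f \<in> C \<Longrightarrow> sublinear f" and below: "\<And>f v. f \<in> C \<Longrightarrow> f v \<le> d v"
      using CA by (auto simp: A_def le_fun_def)
    have inf: "sublinear (\<lambda>v. INF f\<in>C. f v)" "\<And>f v. f \<in> C \<Longrightarrow> (INF f\<in>C. f v) \<le> f v"
      by (rule chain_Inf_sublinear[of C d]; use False sub below chain in blast)+
    obtain f0 where "f0 \<in> C" using False by blast
    then have "(INF f\<in>C. f v) \<le> d v" for v
      using inf(2)[of f0 v] below[of f0 v] by simp
    then show ?thesis
      using inf by (intro bexI[of _ "\<lambda>v. INF f\<in>C. f v"]) (auto simp: A_def le_fun_def)
  qed
  obtain m where m: "m \<in> A" "\<forall>a\<in>A. a \<le> m \<longrightarrow> a = m"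
    using predicate_Zorn[OF po ub] by blast
  have "linear m"
  proof (rule minimal_sublinear_imp_linear)
    fix q' assume "sublinear q'" "\<And>v. q' v \<le> m v"
    moreover then have "q' \<le> d" using m(1) by (auto simp: A_def le_fun_def intro: order_trans)
    ultimately show "q' = m" using m(2) by (auto simp: A_def le_fun_def)
  qed (use m(1) in \<open>simp add: A_def\<close>)
  then show ?thesis using m(1) by (auto simp: A_def le_fun_def)
qed

text \<open>Tilting first along \<open>u\<close> forces the value at \<open>u\<close>, because the tilted functional is \<open>- d u\<close> at \<open>- u\<close>.\<close>

lemma hahn_banach_at_point:
  fixes d :: "'a::real_vector \<Rightarrow> real"
  assumes d: "sublinear d"
  shows "\<exists>p. linear p \<and> (\<forall>v. p v \<le> d v) \<and> p u = d u"
proof -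
  obtain p where p: "linear p" "\<And>v. p v \<le> tilt d u v"
    using sublinear_dominates_linear[OF tilt_sublinear[OF d]] by blast
  have le: "p v \<le> d v" for v
    using p(2)[of v] tilt_le_self[OF d, of u v] by simp
  have "p (- u) \<le> - d u"
    using p(2)[of "- u"] tilt_le[OF d, of 1 u "- u"] sublinear_zero[OF d] by simp
  then have "d u \<le> p u" using p(1) by (simp add: linear_neg)
  with p(1) le show ?thesis by (intro exI[of _ p]) (auto intro: antisym)
qed

section \<open>Quasiorthogonality and Birkhoff orthogonality\<close>

lemma line_distance_sublinear:
  fixes z :: "'a::real_normed_vector"
  shows "sublinear (\<lambda>v. INF s. norm (v + s *\<^sub>R z))"
proof -
  have bdd: "bdd_below (range (\<lambda>s. norm (v + s *\<^sub>R z)))" for v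
    by (rule bdd_belowI2[of _ 0]) simp
  have low: "(INF s. norm (v + s *\<^sub>R z)) \<le> norm (v + s *\<^sub>R z)" for v s
    using bdd by (intro cINF_lower) auto
  show ?thesis
  proof (rule sublinearI)
    fix v w
    have "(INF s. norm (v + w + s *\<^sub>R z)) \<le> norm (v + s *\<^sub>R z) + norm (w + t *\<^sub>R z)" for s t
    proof -
      have "(INF s. norm (v + w + s *\<^sub>R z)) \<le> norm (v + w + (s + t) *\<^sub>R z)" by (rule low)
      also have "v + w + (s + t) *\<^sub>R z = (v + s *\<^sub>R z) + (w + t *\<^sub>R z)"
        by (simp add: algebra_simps)
      finally show ?thesis using norm_triangle_ineq order_trans by blast
    qed
    then have "(INF s. norm (v + w + s *\<^sub>R z)) - norm (w + t *\<^sub>R z) \<le> (INF s. norm (v + s *\<^sub>R z))" for t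
      by (intro cINF_greatest) (auto simp: algebra_simps)
    then have "(INF s. norm (v + w + s *\<^sub>R z)) - (INF s. norm (v + s *\<^sub>R z)) \<le> (INF s. norm (w + s *\<^sub>R z))"
      by (intro cINF_greatest) (auto simp: algebra_simps)
    then show "(INF s. norm (v + w + s *\<^sub>R z)) \<le> (INF s. norm (v + s *\<^sub>R z)) + (INF s. norm (w + s *\<^sub>R z))"
      by simp
  next
    have "(INF s. norm (0 + s *\<^sub>R z)) \<le> 0" using low[of 0 0] by simp
    moreover have "0 \<le> (INF s. norm (0 + s *\<^sub>R z))" by (intro cINF_greatest) auto
    ultimately show "(INF s. norm (0 + s *\<^sub>R z)) = 0" by simp
  next
    fix c :: real and v assume c: "0 < c"
    have "(INF s. norm (c *\<^sub>R v + s *\<^sub>R z)) / c \<le> (INF s. norm (v + s *\<^sub>R z))"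
    proof (rule cINF_greatest)
      fix s
      have "(INF s. norm (c *\<^sub>R v + s *\<^sub>R z)) \<le> norm (c *\<^sub>R v + (c * s) *\<^sub>R z)" by (rule low)
      also have "c *\<^sub>R v + (c * s) *\<^sub>R z = c *\<^sub>R (v + s *\<^sub>R z)" by (simp add: scaleR_add_right)
      also have "norm \<dots> = c * norm (v + s *\<^sub>R z)" using c by simp
      finally show "(INF s. norm (c *\<^sub>R v + s *\<^sub>R z)) / c \<le> norm (v + s *\<^sub>R z)"
        using c by (simp add: divide_le_eq mult.commute)
    qed simp
    then show "(INF s. norm (c *\<^sub>R v + s *\<^sub>R z)) \<le> c * (INF s. norm (v + s *\<^sub>R z))"
      using c by (simp add: divide_le_eq mult.commute)
  qed
qed

text \<open>
  A linear functional dominated by the distance to the line \<open>\<real> z\<close> is dominated by the norm and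
  vanishes on \<open>z\<close>; orthogonality says that this distance is \<open>1\<close> at \<open>u\<close>, the value to be attained.
\<close>

lemma quasiorthogonalI:
  fixes u z :: "'a::real_normed_vector"
  assumes u: "norm u = 1" and orth: "\<And>s. 1 \<le> norm (u + s *\<^sub>R z)"
  shows "quasiorthogonal z u"
proof -
  define d where "d = (\<lambda>v. INF s. norm (v + s *\<^sub>R z))"
  have low: "d v \<le> norm (v + s *\<^sub>R z)" for v s
    unfolding d_def by (intro cINF_lower bdd_belowI2[of _ 0]) auto
  have "1 \<le> d u" unfolding d_def using orth by (intro cINF_greatest) auto
  then have du: "d u = 1" using low[of u 0] u by simp
  obtain p where p: "linear p" "\<And>v. p v \<le> d v" "p u = 1"
    using hahn_banach_at_point[of d u] line_distance_sublinear[of z] du by (auto simp: d_def)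
  have le: "p v \<le> norm v" for v using p(2)[of v] low[of v 0] by simp
  have abs: "\<bar>p v\<bar> \<le> norm v" for v
    using le[of v] le[of "- v"] p(1) by (simp add: linear_neg)
  have "p z \<le> 0" using p(2)[of z] low[of z "-1"] by simp
  moreover have "- p z \<le> 0" using p(2)[of "- z"] low[of "- z" 1] p(1) by (simp add: linear_neg)
  ultimately have pz: "p z = 0" by simp
  have bl: "bounded_linear p"
    using p(1) abs by (intro bounded_linear_intro[of _ 1]) (auto simp: linear_add linear_scale)
  have "norm (Blinfun p) \<le> 1"
    using abs by (intro norm_blinfun_bound) (auto simp: bounded_linear_Blinfun_apply[OF bl])
  moreover have "1 \<le> norm (Blinfun p)"
    using norm_blinfun[of "Blinfun p" u] u p(3) by (simp add: bounded_linear_Blinfun_apply[OF bl])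
  ultimately show ?thesis
    unfolding quasiorthogonal_def
    by (intro exI[of _ "Blinfun p"]) (simp add: bounded_linear_Blinfun_apply[OF bl] u p(3) pz)
qed

lemma quasiorthogonal_height_le_norm:
  assumes "quasiorthogonal y x" "norm x = 1"
  shows "\<bar>a\<bar> \<le> norm (a *\<^sub>R x + s *\<^sub>R y)"
proof -
  from assms obtain p :: "'a \<Rightarrow>\<^sub>L real" where
    p: "norm p = 1" "blinfun_apply p x = 1" "blinfun_apply p y = 0"
    by (auto simp: quasiorthogonal_def)
  then show ?thesis
    using norm_blinfun[of p "a *\<^sub>R x + s *\<^sub>R y"] by (simp add: blinfun.add_right blinfun.scaleR_right)
qed

lemma quasiorthogonal_minus_left: "quasiorthogonal y x \<Longrightarrow> quasiorthogonal (- y) x"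
  by (auto simp: quasiorthogonal_def blinfun.minus_right)

text \<open>
  The vector is the normalised point of the line \<open>w + \<real> z\<close> closest to the origin; it exists by
  compactness, as the norm is large far out on the line.
\<close>

lemma birkhoff_unit_exists:
  fixes z w :: "'a::real_normed_vector"
  assumes "z \<noteq> 0" "w \<notin> span {z}"
  obtains c s where "c \<noteq> 0" "norm (c *\<^sub>R w + s *\<^sub>R z) = 1" "quasiorthogonal z (c *\<^sub>R w + s *\<^sub>R z)"
proof -
  define R where "R = 2 * norm w / norm z"
  have R: "0 \<le> R" by (simp add: R_def)
  have "\<exists>s0\<in>{-R..R}. \<forall>s\<in>{-R..R}. norm (w + s0 *\<^sub>R z) \<le> norm (w + s *\<^sub>R z)"
    using R by (intro continuous_attains_inf) (auto intro!: continuous_intros)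
  then obtain s0 where s0: "\<And>s. s \<in> {-R..R} \<Longrightarrow> norm (w + s0 *\<^sub>R z) \<le> norm (w + s *\<^sub>R z)" by blast
  have min: "norm (w + s0 *\<^sub>R z) \<le> norm (w + s *\<^sub>R z)" for s
  proof (cases "s \<in> {-R..R}")
    case False
    then have "R < \<bar>s\<bar>" by auto
    then have "2 * norm w < norm (s *\<^sub>R z)"
      using assms(1) by (simp add: R_def divide_less_eq)
    then have "norm w < norm (w + s *\<^sub>R z)"
      using norm_triangle_ineq4[of "w + s *\<^sub>R z" w] by simp
    moreover have "norm (w + s0 *\<^sub>R z) \<le> norm w" using s0[of 0] R by simp
    ultimately show ?thesis by simp
  qed (rule s0)
  have "w + s0 *\<^sub>R z \<noteq> 0"
  proof
    assume "w + s0 *\<^sub>R z = 0"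
    then have "w = (- s0) *\<^sub>R z" by (simp add: eq_neg_iff_add_eq_0)
    then have "w \<in> span {z}" using span_base[of z "{z}"] span_scale by blast
    with assms(2) show False by simp
  qed
  define n where "n = norm (w + s0 *\<^sub>R z)"
  have n: "0 < n" using \<open>w + s0 *\<^sub>R z \<noteq> 0\<close> by (simp add: n_def)
  define u where "u = inverse n *\<^sub>R w + (inverse n * s0) *\<^sub>R z"
  have u: "u = inverse n *\<^sub>R (w + s0 *\<^sub>R z)" by (simp add: u_def algebra_simps)
  then have nu: "norm u = 1" using n by (simp add: n_def[symmetric])
  have "1 \<le> norm (u + s *\<^sub>R z)" for s
  proof -
    have "u + s *\<^sub>R z = inverse n *\<^sub>R (w + (s0 + n * s) *\<^sub>R z)"
      using n by (simp add: u algebra_simps)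
    then have "norm (u + s *\<^sub>R z) = norm (w + (s0 + n * s) *\<^sub>R z) / n"
      using n by (simp add: divide_inverse mult.commute)
    then show ?thesis using min[of "s0 + n * s"] n by (simp add: n_def[symmetric])
  qed
  then have "quasiorthogonal z u" by (rule quasiorthogonalI[OF nu])
  with n nu that[of "inverse n" "inverse n * s0"] show thesis by (simp add: u_def)
qed

section \<open>The supporting depth\<close>

text \<open>
  At parameter \<open>0\<close> the point \<open>x + t y\<close> has norm at least \<open>1\<close>, at parameter \<open>t\<close> the point
  \<open>(1 - t) x + t y\<close> has norm at most \<open>1\<close>; the sphere is crossed in between.  As \<open>y\<close> is quasiorthogonal to \<open>x\<close>, no crossing
  has a negative parameter, and compactness provides a first one.
\<close>

lemma supp_depth_properties:
  fixes x y :: "'a::real_normed_vector"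
  assumes x: "norm x = 1" and y: "norm y = 1" and q: "quasiorthogonal y x" and t: "0 \<le> t" "t \<le> 1"
  shows supp_depth_on_sphere: "norm (x + t *\<^sub>R y - supp_depth x y t *\<^sub>R x) = 1"
    and supp_depth_nonneg: "0 \<le> supp_depth x y t"
    and supp_depth_le: "supp_depth x y t \<le> t"
proof -
  define f where "f = (\<lambda>l. norm (x + t *\<^sub>R y - l *\<^sub>R x))"
  have cont: "continuous_on A f" for A unfolding f_def by (intro continuous_intros)
  have shape: "x + t *\<^sub>R y - l *\<^sub>R x = (1 - l) *\<^sub>R x + t *\<^sub>R y" for l by (simp add: algebra_simps)
  have height: "\<bar>1 - l\<bar> \<le> f l" for l
    unfolding f_def shape by (rule quasiorthogonal_height_le_norm[OF q x])
  have "f t \<le> norm ((1 - t) *\<^sub>R x) + norm (t *\<^sub>R y)"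
    unfolding f_def shape by (rule norm_triangle_ineq)
  then have "f t \<le> 1" using x y t by simp
  moreover have "1 \<le> f 0" using height[of 0] by simp
  ultimately obtain l1 where l1: "0 \<le> l1" "l1 \<le> t" "f l1 = 1"
    using IVT2'[of f t 1 0] t cont by blast
  define S where "S = {0..1} \<inter> f -` {1}"
  have "compact S"
    unfolding S_def compact_eq_bounded_closed
    using continuous_closed_preimage[OF cont[of "{0..1}"], of "{1}"] by (auto intro: bounded_Int)
  moreover have "S \<noteq> {}" using l1 t by (force simp: S_def)
  ultimately obtain l0 where l0: "l0 \<in> S" "\<And>l. l \<in> S \<Longrightarrow> l0 \<le> l"
    using compact_attains_inf[of S] by blast
  have least: "l0 \<le> l" if l: "f l = 1" for l
  proof (cases "l \<le> 1")
    case True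
    then have "l \<in> S" using l height[of l] by (auto simp: S_def)
    then show ?thesis by (rule l0(2))
  next
    case False
    then show ?thesis using l0(1) by (auto simp: S_def)
  qed
  have "supp_depth x y t = l0"
    unfolding supp_depth_def
    using l0(1) least by (intro Least_equality) (auto simp: S_def f_def)
  with l0(1) l1(2) least[OF l1(3)]
  show "norm (x + t *\<^sub>R y - supp_depth x y t *\<^sub>R x) = 1" "0 \<le> supp_depth x y t"
    "supp_depth x y t \<le> t"
    by (auto simp: S_def f_def)
qed

lemma supp_depth_ge:
  fixes x y :: "'a::real_normed_vector"
  assumes "norm x = 1" "norm y = 1" "quasiorthogonal y x" "0 \<le> t" "t \<le> 1"
    and out: "\<And>a. \<alpha> < a \<Longrightarrow> norm (a *\<^sub>R x + t *\<^sub>R y) \<noteq> 1"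
  shows "1 - \<alpha> \<le> supp_depth x y t"
proof (rule ccontr)
  let ?l = "supp_depth x y t"
  assume "\<not> 1 - \<alpha> \<le> ?l"
  then have "norm ((1 - ?l) *\<^sub>R x + t *\<^sub>R y) \<noteq> 1" by (intro out) simp
  then show False
    using supp_depth_on_sphere[OF assms(1-5)] by (simp add: algebra_simps)
qed

section \<open>Suprema defining the moduli\<close>

lemma supp_depth_le_modulus:
  fixes x y :: "'a::real_normed_vector"
  assumes "norm x = 1" "norm y = 1" "quasiorthogonal y x" "0 \<le> t" "t \<le> r" "r \<le> 1"
  shows "supp_depth x y t \<le> supp_smoothness_modulus TYPE('a) r"
  unfolding supp_smoothness_modulus_def
proof (rule cSup_upper)
  show "supp_depth x y t \<in> {supp_depth x y t |(x :: 'a) y t.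
      x \<in> sphere 0 1 \<and> y \<in> sphere 0 1 \<and> quasiorthogonal y x \<and> 0 \<le> t \<and> t \<le> r}"
    using assms by fastforce
  show "bdd_above {supp_depth x y t |(x :: 'a) y t.
      x \<in> sphere 0 1 \<and> y \<in> sphere 0 1 \<and> quasiorthogonal y x \<and> 0 \<le> t \<and> t \<le> r}"
    using assms(6) by (intro bdd_aboveI[of _ r]) (fastforce intro: order_trans[OF supp_depth_le])
qed

lemma chord_sagitta_le_modulus:
  fixes x y :: "'a::real_normed_vector"
  assumes "norm x = 1" "norm y = 1" "norm (x - y) \<le> e"
  shows "1 - norm (x + y) / 2 \<le> Banas_modulus TYPE('a) e"
  unfolding Banas_modulus_def
proof (rule cSup_upper)
  show "1 - norm (x + y) / 2 \<in> {1 - norm (x + y) / 2 |(x :: 'a) y.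
      x \<in> sphere 0 1 \<and> y \<in> sphere 0 1 \<and> norm (x - y) \<le> e}"
    using assms by fastforce
  show "bdd_above {1 - norm (x + y) / 2 |(x :: 'a) y.
      x \<in> sphere 0 1 \<and> y \<in> sphere 0 1 \<and> norm (x - y) \<le> e}"
    by (intro bdd_aboveI[of _ 1]) auto
qed

text \<open>Dimension at least two enters only through an independent pair of vectors.\<close>

lemma quasiorthogonal_pair_exists:
  fixes e w :: "'a::real_normed_vector"
  assumes "e \<noteq> 0" "w \<notin> span {e}"
  obtains x y :: 'a where "norm x = 1" "norm y = 1" "quasiorthogonal y x"
proof -
  obtain c s where "norm (c *\<^sub>R w + s *\<^sub>R e) = 1" "quasiorthogonal e (c *\<^sub>R w + s *\<^sub>R e)"
    using birkhoff_unit_exists[OF assms] by blast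
  moreover then have "quasiorthogonal (inverse (norm e) *\<^sub>R e) (c *\<^sub>R w + s *\<^sub>R e)"
    by (auto simp: quasiorthogonal_def blinfun.scaleR_right)
  ultimately show thesis
    using that[of "c *\<^sub>R w + s *\<^sub>R e" "inverse (norm e) *\<^sub>R e"] assms(1) by simp
qed

section \<open>A chord is no deeper than the supporting depth\<close>

lemma norm_segment_less_one:
  fixes P Q :: "'a::real_normed_vector"
  assumes "norm P < 1" "norm Q \<le> 1" "0 \<le> \<theta>" "\<theta> < 1"
  shows "norm ((1 - \<theta>) *\<^sub>R P + \<theta> *\<^sub>R Q) < 1"
proof -
  have "norm ((1 - \<theta>) *\<^sub>R P + \<theta> *\<^sub>R Q) \<le> (1 - \<theta>) * norm P + \<theta> * norm Q"
    using norm_triangle_ineq[of "(1 - \<theta>) *\<^sub>R P" "\<theta> *\<^sub>R Q"] assms(3,4) by simp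
  also have "\<dots> < (1 - \<theta>) * 1 + \<theta> * 1"
    using assms by (intro add_less_le_mono mult_strict_left_mono mult_left_mono) auto
  finally show ?thesis by simp
qed

lemma norm_line_less_one:
  fixes P Q :: "'a::real_normed_vector"
  assumes "norm (P + i *\<^sub>R Q) < 1" "norm (P + k *\<^sub>R Q) \<le> 1"
    and "i \<le> j \<and> j < k \<or> k < j \<and> j \<le> i"
  shows "norm (P + j *\<^sub>R Q) < 1"
proof -
  define \<theta> where "\<theta> = (j - i) / (k - i)"
  have ne: "k - i \<noteq> 0" using assms(3) by auto
  have \<theta>: "0 \<le> \<theta>" "\<theta> < 1" using assms(3) by (auto simp: \<theta>_def field_simps)
  have "\<theta> * (k - i) = j - i" using ne by (simp add: \<theta>_def)
  then have j: "j = i + \<theta> * (k - i)" by simp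
  have "P + j *\<^sub>R Q = (1 - \<theta>) *\<^sub>R (P + i *\<^sub>R Q) + \<theta> *\<^sub>R (P + k *\<^sub>R Q)"
    unfolding j by (simp add: algebra_simps)
  then show ?thesis using norm_segment_less_one[OF assms(1,2) \<theta>] by simp
qed

text \<open>
  The chord has the ends \<open>\<alpha> u + (\<beta> \<plusminus> t) z\<close>.  On the line at height \<open>\<alpha>\<close> the point \<open>\<alpha> u\<close> is interior to
  the ball, so \<open>\<beta> - t \<le> 0\<close>; as \<open>- t \<le> \<beta> - t\<close>, the point \<open>\<alpha> u - t z\<close> is not interior.  On the line
  \<open>- t z + \<real> u\<close> the point \<open>- t z\<close> is interior, so all points above height \<open>\<alpha>\<close> are outside.
\<close>

lemma supp_depth_ge_of_chord:
  fixes u z :: "'a::real_normed_vector"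
  assumes u: "norm u = 1" and z: "norm z = 1" and q: "quasiorthogonal z u"
    and t: "0 < t" "t < 1" and \<alpha>: "0 \<le> \<alpha>" "\<alpha> < 1" and \<beta>: "0 \<le> \<beta>"
    and ends: "norm (\<alpha> *\<^sub>R u + (\<beta> + t) *\<^sub>R z) = 1" "norm (\<alpha> *\<^sub>R u + (\<beta> - t) *\<^sub>R z) = 1"
  shows "1 - \<alpha> \<le> supp_depth u (- z) t"
proof (rule supp_depth_ge)
  have mid: "norm (\<alpha> *\<^sub>R u + 0 *\<^sub>R z) < 1" using u \<alpha> by simp
  have le: "\<beta> - t \<le> 0"
    using norm_line_less_one[OF mid, of "\<beta> + t" "\<beta> - t"] ends t by fastforce
  have corner: "1 \<le> norm (\<alpha> *\<^sub>R u + (- t) *\<^sub>R z)"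
  proof (rule ccontr)
    assume "\<not> 1 \<le> norm (\<alpha> *\<^sub>R u + (- t) *\<^sub>R z)"
    then have small: "norm (\<alpha> *\<^sub>R u + (- t) *\<^sub>R z) < 1" by simp
    have "\<beta> - t < 0" using le ends(2) mid by (cases "\<beta> - t = 0") auto
    then show False
      using norm_line_less_one[OF small less_imp_le[OF mid], of "\<beta> - t"] ends(2) \<beta> by auto
  qed
  fix a assume a: "\<alpha> < a"
  show "norm (a *\<^sub>R u + t *\<^sub>R - z) \<noteq> 1"
  proof
    assume "norm (a *\<^sub>R u + t *\<^sub>R - z) = 1"
    then have top: "norm ((- t) *\<^sub>R z + a *\<^sub>R u) \<le> 1" by (simp add: algebra_simps)
    have bot: "norm ((- t) *\<^sub>R z + 0 *\<^sub>R u) < 1" using z t by simp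
    have "norm ((- t) *\<^sub>R z + \<alpha> *\<^sub>R u) < 1"
      using norm_line_less_one[OF bot top, of \<alpha>] a \<alpha> by auto
    then show False using corner by (simp add: add.commute)
  qed
qed (use assms quasiorthogonal_minus_left in auto)

lemma chord_sagitta_le_supp_depth:
  fixes x y :: "'a::real_normed_vector"
  assumes x: "norm x = 1" and y: "norm y = 1" and t: "0 < norm (x - y)" "norm (x - y) < 2"
  obtains u v :: 'a where "norm u = 1" "norm v = 1" "quasiorthogonal v u"
    "1 - norm (x + y) / 2 \<le> supp_depth u v (norm (x - y) / 2)"
proof -
  define t where "t = norm (x - y) / 2"
  have t01: "0 < t" "t < 1" using t by (auto simp: t_def)
  define z where "z = inverse (2 * t) *\<^sub>R (x - y)"
  have z: "norm z = 1" using t01 by (simp add: z_def t_def)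
  have xy: "x - y = (2 * t) *\<^sub>R z" using t01 by (simp add: z_def)
  have "x \<notin> span {z}"
  proof
    assume "x \<in> span {z}"
    then obtain k where k: "x = k *\<^sub>R z" by (auto simp: span_singleton)
    have "y = (k - 2 * t) *\<^sub>R z" using xy k by (simp add: algebra_simps)
    then have "\<bar>k\<bar> = 1" "\<bar>k - 2 * t\<bar> = 1" using x y k z by auto
    then show False using t01 by (auto simp: abs_if split: if_splits)
  qed
  moreover have "z \<noteq> 0" using z by auto
  ultimately obtain c s where cs: "c \<noteq> 0" "norm (c *\<^sub>R x + s *\<^sub>R z) = 1"
      "quasiorthogonal z (c *\<^sub>R x + s *\<^sub>R z)"
    using birkhoff_unit_exists by blast
  \<comment> \<open>The sign makes the height of the chord over \<open>\<real> z\<close> positive.\<close>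
  define u where "u = sgn c *\<^sub>R (c *\<^sub>R x + s *\<^sub>R z)"
  have u: "norm u = 1" using cs by (simp add: u_def abs_sgn_eq)
  have q: "quasiorthogonal z u"
  proof (rule quasiorthogonalI[OF u])
    fix s' show "1 \<le> norm (u + s' *\<^sub>R z)"
      using quasiorthogonal_height_le_norm[OF cs(3,2), of "sgn c" s'] cs(1)
      by (simp add: u_def abs_sgn_eq)
  qed
  define \<alpha> where "\<alpha> = inverse \<bar>c\<bar>"
  define \<gamma> where "\<gamma> = - s / c"
  have xu: "x = \<alpha> *\<^sub>R u + \<gamma> *\<^sub>R z"
    using cs(1) by (cases "0 < c") (auto simp: \<alpha>_def \<gamma>_def u_def algebra_simps divide_inverse)
  define \<beta> where "\<beta> = \<gamma> - t"
  have X: "x = \<alpha> *\<^sub>R u + (\<beta> + t) *\<^sub>R z" using xu by (simp add: \<beta>_def)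
  have yx: "y = x - (2 * t) *\<^sub>R z" by (simp flip: xy)
  have "y = \<alpha> *\<^sub>R u + (\<beta> + t - 2 * t) *\<^sub>R z"
    unfolding yx X scaleR_diff_left[of "\<beta> + t"] by simp
  then have Y: "y = \<alpha> *\<^sub>R u + (\<beta> - t) *\<^sub>R z" by simp
  have "x + y = (2 * \<alpha>) *\<^sub>R u + (2 * \<beta>) *\<^sub>R z"
    by (simp add: X Y algebra_simps flip: scaleR_2)
  then have m: "\<alpha> \<le> norm (x + y) / 2"
    using quasiorthogonal_height_le_norm[OF q u, of "2 * \<alpha>" "2 * \<beta>"] by simp
  have \<alpha>: "0 \<le> \<alpha>" by (simp add: \<alpha>_def)
  consider "1 \<le> \<alpha>" | "\<alpha> < 1" "0 \<le> \<beta>" | "\<alpha> < 1" "\<beta> \<le> 0" by linarith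
  then show thesis
  proof cases
    case 1
    have "0 \<le> supp_depth u z t" using supp_depth_nonneg[OF u z q] t01 by simp
    then show thesis using 1 m that[OF u z q] by (simp add: t_def)
  next
    case 2
    have "1 - \<alpha> \<le> supp_depth u (- z) t"
      using supp_depth_ge_of_chord[OF u z q t01 \<alpha> 2] X Y x y by simp
    then show thesis
      using m that[OF u _ quasiorthogonal_minus_left[OF q]] z by (simp add: t_def)
  next
    case 3
    \<comment> \<open>The mirror image of the previous case under \<open>z \<mapsto> - z\<close>.\<close>
    have "\<alpha> *\<^sub>R u + (- \<beta> + t) *\<^sub>R (- z) = y" "\<alpha> *\<^sub>R u + (- \<beta> - t) *\<^sub>R (- z) = x"
      by (simp_all add: X Y algebra_simps)
    then have "1 - \<alpha> \<le> supp_depth u (- (- z)) t"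
      using supp_depth_ge_of_chord[OF u _ quasiorthogonal_minus_left[OF q] t01 \<alpha> 3(1), of "- \<beta>"]
        3(2) x y z by simp
    then show thesis using m that[OF u z q] by (simp add: t_def)
  qed
qed

text \<open>
  In a plane, let \<open>v\<close> be the last point in the direction \<open>e\<close> of a face of the ball parallel to \<open>e\<close>,
  and let \<open>u\<close> be a unit vector to which \<open>v\<close> is quasiorthogonal.  If \<open>u\<close> is not parallel to the
  face, moving from \<open>v\<close> or from \<open>- v\<close> along \<open>u\<close> leaves the strip between the face and its mirror
  image; if \<open>u\<close> is parallel to it, moving from \<open>v\<close> or from \<open>- v\<close> along \<open>u\<close> leaves the face at its end.
  So the sphere is left at once when moving upwards from height \<open>0\<close>.
\<close>

lemma supp_depth_one_exists:
  fixes e w :: "'a::real_normed_vector"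
  assumes "e \<noteq> 0" "w \<notin> span {e}"
  obtains u v :: 'a where "norm u = 1" "norm v = 1" "quasiorthogonal v u" "1 \<le> supp_depth u v 1"
proof -
  obtain c s where "c \<noteq> 0" and v0': "norm (c *\<^sub>R w + s *\<^sub>R e) = 1" "quasiorthogonal e (c *\<^sub>R w + s *\<^sub>R e)"
    using birkhoff_unit_exists[OF assms] by blast
  define v0 where "v0 = c *\<^sub>R w + s *\<^sub>R e"
  note v0 = v0'[folded v0_def]
  define F where "F = {a. norm (v0 + a *\<^sub>R e) = 1}"
  have "closed F"
    unfolding F_def by (intro closed_Collect_eq continuous_intros)
  moreover have "bounded F"
    unfolding bounded_iff
  proof (intro exI[of _ "2 / norm e"] ballI)
    fix a assume "a \<in> F"
    then have "norm (a *\<^sub>R e) \<le> 2"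
      using norm_triangle_ineq4[of "v0 + a *\<^sub>R e" v0] v0(1) by (simp add: F_def)
    then show "norm a \<le> 2 / norm e" using assms(1) by (simp add: le_divide_eq)
  qed
  moreover have "0 \<in> F" using v0(1) by (simp add: F_def)
  ultimately obtain A where A: "A \<in> F" "\<And>a. a \<in> F \<Longrightarrow> a \<le> A"
    using compact_attains_sup[of F] by (auto simp: compact_eq_bounded_closed)
  define v where "v = v0 + A *\<^sub>R e"
  have v: "norm v = 1" using A(1) by (simp add: v_def F_def)
  have off: "norm (v + a *\<^sub>R e) \<noteq> 1" if "0 < a" for a
  proof
    assume "norm (v + a *\<^sub>R e) = 1"
    then have "A + a \<in> F" by (simp add: F_def v_def algebra_simps)
    then show False using A(2)[of "A + a"] that by simp
  qed
  have strip: "\<bar>k\<bar> \<le> norm (k *\<^sub>R v + a *\<^sub>R e)" for k a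
    using quasiorthogonal_height_le_norm[OF v0(2,1), of k "k * A + a"]
    by (simp add: v_def algebra_simps)
  have "e \<notin> span {v}"
  proof
    assume "e \<in> span {v}"
    then obtain k where k: "e = k *\<^sub>R v" by (auto simp: span_singleton)
    then have "k \<noteq> 0" using assms(1) by auto
    moreover have "\<bar>k\<bar> \<le> norm (k *\<^sub>R v + (-1) *\<^sub>R e)" by (rule strip)
    ultimately show False using k by simp
  qed
  moreover have "v \<noteq> 0" using v by auto
  ultimately obtain c1 c2 where u': "c1 \<noteq> 0" "norm (c1 *\<^sub>R e + c2 *\<^sub>R v) = 1"
      "quasiorthogonal v (c1 *\<^sub>R e + c2 *\<^sub>R v)"
    using birkhoff_unit_exists by blast
  define u where "u = c1 *\<^sub>R e + c2 *\<^sub>R v"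
  note u = u'(2,3)[folded u_def]
  define \<sigma> where "\<sigma> = (if c2 = 0 then sgn c1 else sgn c2)"
  have \<sigma>: "\<sigma> = 1 \<or> \<sigma> = -1" using u'(1) by (auto simp: \<sigma>_def sgn_if)
  have out: "norm (a *\<^sub>R u + 1 *\<^sub>R (\<sigma> *\<^sub>R v)) \<noteq> 1" if a: "0 < a" for a
  proof (cases "c2 = 0")
    case False
    have eq: "a *\<^sub>R u + 1 *\<^sub>R (\<sigma> *\<^sub>R v) = (\<sigma> + a * c2) *\<^sub>R v + (a * c1) *\<^sub>R e"
      by (simp add: u_def algebra_simps)
    have "1 < \<bar>\<sigma> + a * c2\<bar>"
    proof (cases "0 < c2")
      case True
      then show ?thesis using a mult_pos_pos[of a c2] by (simp add: \<sigma>_def)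
    next
      case neg: False
      then have "a * c2 < 0" using a False by (simp add: mult_less_0_iff)
      then show ?thesis using neg False by (simp add: \<sigma>_def)
    qed
    then show ?thesis using strip[of "\<sigma> + a * c2" "a * c1"] unfolding eq by linarith
  next
    case True
    then have "a *\<^sub>R u + 1 *\<^sub>R (\<sigma> *\<^sub>R v) = \<sigma> *\<^sub>R (v + (a * \<bar>c1\<bar>) *\<^sub>R e)"
      using u'(1) by (cases "0 < c1") (auto simp: u_def \<sigma>_def algebra_simps)
    moreover have "0 < a * \<bar>c1\<bar>" using a u'(1) by simp
    ultimately show ?thesis using off \<sigma> by auto
  qed
  have nv: "norm (\<sigma> *\<^sub>R v) = 1" using \<sigma> v by auto
  have q: "quasiorthogonal (\<sigma> *\<^sub>R v) u" using \<sigma> u(2) quasiorthogonal_minus_left by auto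
  have "1 \<le> supp_depth u (\<sigma> *\<^sub>R v) 1"
    using supp_depth_ge[OF u(1) nv q, of 1 0] out by simp
  with u(1) nv q that show thesis by blast
qed

lemma Banas_modulus_le_supp_smoothness_modulus:
  fixes e w :: "'a::real_normed_vector"
  assumes e: "e \<noteq> 0" "w \<notin> span {e}" and r: "0 \<le> r" "r \<le> 1"
  shows "Banas_modulus TYPE('a) (2 * r) \<le> supp_smoothness_modulus TYPE('a) r"
proof -
  have "1 - norm (x + y) / 2 \<le> supp_smoothness_modulus TYPE('a) r"
    if x: "norm x = 1" and y: "norm y = 1" and d: "norm (x - y) \<le> 2 * r" for x y :: 'a
  proof -
    consider "x = y" | "0 < norm (x - y)" "norm (x - y) < 2" | "r = 1" "x \<noteq> y"
      using d r by fastforce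
    then show ?thesis
    proof cases
      case 1
      obtain u v :: 'a where uv: "norm u = 1" "norm v = 1" "quasiorthogonal v u"
        using quasiorthogonal_pair_exists[OF e] by blast
      have "0 \<le> supp_smoothness_modulus TYPE('a) r"
        using supp_depth_nonneg[OF uv, of 0] supp_depth_le_modulus[OF uv, of 0 r] r by simp
      moreover have "norm (x + y) = 2" using 1 x by (simp flip: scaleR_2)
      ultimately show ?thesis by simp
    next
      case 2
      obtain u v :: 'a where uv: "norm u = 1" "norm v = 1" "quasiorthogonal v u"
        "1 - norm (x + y) / 2 \<le> supp_depth u v (norm (x - y) / 2)"
        using chord_sagitta_le_supp_depth[OF x y 2] by blast
      have "supp_depth u v (norm (x - y) / 2) \<le> supp_smoothness_modulus TYPE('a) r"
        using uv d r by (intro supp_depth_le_modulus) auto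
      with uv(4) show ?thesis by simp
    next
      case 3
      obtain u v :: 'a where uv: "norm u = 1" "norm v = 1" "quasiorthogonal v u" "1 \<le> supp_depth u v 1"
        using supp_depth_one_exists[OF e] by blast
      have "1 - norm (x + y) / 2 \<le> 1" by simp
      also have "1 \<le> supp_depth u v 1" by (rule uv(4))
      also have "\<dots> \<le> supp_smoothness_modulus TYPE('a) r"
        using uv 3 by (intro supp_depth_le_modulus) auto
      finally show ?thesis .
    qed
  qed
  moreover obtain x :: 'a where "norm x = 1" using quasiorthogonal_pair_exists[OF e] by blast
  then have "\<exists>x y :: 'a. norm x = 1 \<and> norm y = 1 \<and> norm (x - y) \<le> 2 * r"
    using r by (intro exI[of _ x]) simp
  ultimately show ?thesis
    unfolding Banas_modulus_def by (intro cSup_least) auto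
qed

section \<open>The supporting depth is at most twice a chord sagitta\<close>

lemma supp_depth_le_chord_sagitta:
  fixes x y :: "'a::real_normed_vector"
  assumes x: "norm x = 1" and y: "norm y = 1" and q: "quasiorthogonal y x" and t: "0 \<le> t" "t \<le> 1"
  obtains a b :: 'a where "norm a = 1" "norm b = 1" "norm (a - b) \<le> 3 * t"
    "supp_depth x y t \<le> 2 * (1 - norm (a + b) / 2)"
proof -
  have y': "norm (- y) = 1" using y by simp
  note q' = quasiorthogonal_minus_left[OF q]
  define l where "l = supp_depth x y t"
  define k where "k = supp_depth x (- y) t"
  define a where "a = x + t *\<^sub>R y - l *\<^sub>R x"
  define b where "b = x + t *\<^sub>R (- y) - k *\<^sub>R x"
  have l: "0 \<le> l" "l \<le> t" and a: "norm a = 1"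
    using supp_depth_properties[OF x y q t] by (auto simp: l_def a_def)
  have k: "0 \<le> k" "k \<le> t" and b: "norm b = 1"
    using supp_depth_properties[OF x y' q' t] by (auto simp: k_def b_def)
  have "a + b = (2 - l - k) *\<^sub>R x" by (simp add: a_def b_def algebra_simps flip: scaleR_2)
  then have sum: "norm (a + b) = 2 - l - k" using x l k t by simp
  have "a - b = (2 * t) *\<^sub>R y + (k - l) *\<^sub>R x"
    by (simp add: a_def b_def algebra_simps flip: scaleR_2)
  then have "norm (a - b) \<le> 2 * t + \<bar>k - l\<bar>"
    using norm_triangle_ineq[of "(2 * t) *\<^sub>R y" "(k - l) *\<^sub>R x"] x y t by simp
  moreover have "\<bar>k - l\<bar> \<le> t" using l k by linarith
  ultimately have "norm (a - b) \<le> 3 * t" by linarith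
  moreover have "l \<le> 2 * (1 - norm (a + b) / 2)" using sum k(1) by (simp add: field_simps)
  ultimately show thesis using that[OF a b] by (simp add: l_def)
qed

lemma supp_smoothness_modulus_le_Banas_modulus:
  fixes e w :: "'a::real_normed_vector"
  assumes e: "e \<noteq> 0" "w \<notin> span {e}" and r: "0 \<le> r" "r \<le> 1"
  shows "supp_smoothness_modulus TYPE('a) r \<le> 2 * Banas_modulus TYPE('a) (3 * r)"
proof -
  have "supp_depth x y t \<le> 2 * Banas_modulus TYPE('a) (3 * r)"
    if xy: "norm x = 1" "norm y = 1" "quasiorthogonal y x" and t: "0 \<le> t" "t \<le> r" for x y :: 'a and t
  proof -
    obtain a b :: 'a where ab: "norm a = 1" "norm b = 1" "norm (a - b) \<le> 3 * t"
      "supp_depth x y t \<le> 2 * (1 - norm (a + b) / 2)"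
      using supp_depth_le_chord_sagitta[OF xy, of t] t r by auto
    have "1 - norm (a + b) / 2 \<le> Banas_modulus TYPE('a) (3 * r)"
      using ab t by (intro chord_sagitta_le_modulus) auto
    with ab(4) show ?thesis by simp
  qed
  moreover obtain x y :: 'a where "norm x = 1" "norm y = 1" "quasiorthogonal y x"
    using quasiorthogonal_pair_exists[OF e] by blast
  then have "\<exists>x y :: 'a. \<exists>t. norm x = 1 \<and> norm y = 1 \<and> quasiorthogonal y x \<and> 0 \<le> t \<and> t \<le> r"
    using r by blast
  ultimately show ?thesis
    unfolding supp_smoothness_modulus_def by (intro cSup_least) auto
qed

section \<open>Equivalence of the two moduli\<close>

theorem theorem3:
  assumes "\<exists>B :: 'a::banach set. independent B \<and> finite B \<and> card B = 2"
  shows "equivalent_at_zero 2 (Banas_modulus TYPE('a)) 1 (supp_smoothness_modulus TYPE('a)) \<and>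
    (\<forall>r\<in>{0..1}. Banas_modulus TYPE('a) (2 * r) \<le> supp_smoothness_modulus TYPE('a) r) \<and>
    (\<forall>r\<in>{0..2/3}. supp_smoothness_modulus TYPE('a) r \<le> 2 * Banas_modulus TYPE('a) (3 * r))"
proof -
  obtain B :: "'a set" where B: "independent B" "card B = 2" using assms by blast
  then obtain e w where ew: "B = {w, e}" "w \<noteq> e" by (auto simp: card_2_iff)
  have e: "e \<noteq> 0" "w \<notin> span {e}"
    using B(1) ew by (auto simp: independent_insert dependent_zero)
  have upper: "Banas_modulus TYPE('a) (2 * r) \<le> supp_smoothness_modulus TYPE('a) r"
    if "r \<in> {0..1}" for r
    using that by (intro Banas_modulus_le_supp_smoothness_modulus[OF e]) auto
  have lower: "supp_smoothness_modulus TYPE('a) r \<le> 2 * Banas_modulus TYPE('a) (3 * r)"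
    if "r \<in> {0..2/3}" for r
    using that by (intro supp_smoothness_modulus_le_Banas_modulus[OF e]) auto
  have pos: "0 \<le> Banas_modulus TYPE('a) t" if "0 \<le> t" for t
  proof -
    obtain x :: 'a where x: "norm x = 1" using quasiorthogonal_pair_exists[OF e] by blast
    then have "norm (x + x) = 2" by (simp flip: scaleR_2)
    then show ?thesis using chord_sagitta_le_modulus[OF x x, of t] that by simp
  qed
  have pos': "0 \<le> supp_smoothness_modulus TYPE('a) t" if "t \<in> {0..1}" for t
    using upper[OF that] pos[of "2 * t"] that by simp
  have bounds: "\<forall>t\<in>{0..2/3}. t \<in> {0..1} \<and> 2 * t \<in> {0..2} \<and> 3 * t \<in> {0..2} \<and>
      1 * Banas_modulus TYPE('a) (2 * t) \<le> supp_smoothness_modulus TYPE('a) t \<and>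
      supp_smoothness_modulus TYPE('a) t \<le> 2 * Banas_modulus TYPE('a) (3 * t)"
    using upper lower by auto
  have "equivalent_at_zero 2 (Banas_modulus TYPE('a)) 1 (supp_smoothness_modulus TYPE('a))"
    unfolding equivalent_at_zero_def
  proof (intro conjI)
    show "\<forall>t\<in>{0..2}. 0 \<le> Banas_modulus TYPE('a) t" using pos by simp
    show "\<forall>t\<in>{0..1}. 0 \<le> supp_smoothness_modulus TYPE('a) t" using pos' by simp
  qed (rule exI[of _ 1], rule exI[of _ 2], rule exI[of _ 2], rule exI[of _ 3], rule exI[of _ "2/3"],
      use bounds in simp)
  with upper lower show ?thesis by blast
qed

end
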